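(* Let $n\ge 1$ be an integer and let $\gamma$ be a sequence in $\mathbb{Z}_n$ of length greater than $3n/2-1$. Then $\gamma$ does not contain a subsequence of length $n$ with sum zero if and only if $\gamma$ is similar to the union $\alpha\cup\beta$ of two sequences $\alpha$ and $\beta$ in $\mathbb{Z}_n$ such that $$L(\alpha)<n\qquad\text{and}\qquad L(1-\beta)<n.$$
   Context: $\mathbb{Z}_n=\mathbb{Z}/n\mathbb{Z}$. Sequences are finite, unordered up to rearrangement, and may have repeated terms. For $a\in\mathbb{Z}_n$, its least positive representative $\overline{a}$ is the unique integer in $[1,n]$ in the class $a$ (so $\overline{0}=n$). For a sequence $\omega$ in $\mathbb{Z}_n$, $L(\omega)$ denotes the integer sum of the least positive representatives of its terms (the empty sequence has $L=0$). For a sequence $\beta$, $1-\beta$ is the sequence obtained by replacing each term $b$ by $1-b$. The union $\alpha\cup\beta$ is the sequence consisting of the terms of $\alpha$ together with the terms of $\beta$. An affine map is a map $x\mapsto ax+b$ on $\mathbb{Z}_n$ with $a$ an integer coprime to $n$ and $b\in\mathbb{Z}_n$. A sequence $\gamma$ is similar to $\delta$ if $\delta$ can be obtained from $\gamma$ by applying an affine map to every term and rearranging terms. *)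

theory Defs
  imports Complex_Main "HOL-Library.Multiset" "HOL-Number_Theory.Cong"
begin

text \<open>
  The group of integers modulo \<open>n\<close> is represented by the canonical residues \<open>0, \<dots>, n - 1\<close> with
  arithmetic modulo \<open>n\<close>. This carrier also covers the trivial case \<open>n = 1\<close>, which the locale
  \<open>residues\<close> excludes. Unordered sequences with repetition are multisets.
\<close>

definition Zmod :: "nat \<Rightarrow> int set" where
  "Zmod n = {0..<int n}"

definition seq_in_Zmod :: "nat \<Rightarrow> int multiset \<Rightarrow> bool" where
  "seq_in_Zmod n \<omega> \<longleftrightarrow> set_mset \<omega> \<subseteq> Zmod n"

definition least_pos_rep :: "nat \<Rightarrow> int \<Rightarrow> int" where
  "least_pos_rep n a = (THE k. 1 \<le> k \<and> k \<le> int n \<and> [k = a] (mod int n))"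

lemma least_pos_rep_ex1:
  assumes "n \<ge> 1"
  shows "\<exists>!k. 1 \<le> k \<and> k \<le> int n \<and> [k = a] (mod int n)"
proof (rule ex1I)
  let ?k = "(a - 1) mod int n + 1"
  have "[?k = a] (mod int n)"
    by (simp add: cong_def mod_simps)
  moreover have "0 \<le> (a - 1) mod int n" "(a - 1) mod int n < int n"
    using assms by simp_all
  ultimately show "1 \<le> ?k \<and> ?k \<le> int n \<and> [?k = a] (mod int n)"
    by linarith
next
  fix k assume k: "1 \<le> k \<and> k \<le> int n \<and> [k = a] (mod int n)"
  then have "[k - 1 = a - 1] (mod int n)"
    by (intro cong_diff) simp_all
  with k show "k = (a - 1) mod int n + 1"
    by (simp add: cong_def)
qed

definition L :: "nat \<Rightarrow> int multiset \<Rightarrow> int" where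
  "L n \<omega> = (\<Sum>a\<in>#\<omega>. least_pos_rep n a)"

definition one_minus :: "nat \<Rightarrow> int multiset \<Rightarrow> int multiset" where
  "one_minus n \<beta> = image_mset (\<lambda>b. (1 - b) mod int n) \<beta>"

definition affine_map :: "nat \<Rightarrow> (int \<Rightarrow> int) \<Rightarrow> bool" where
  "affine_map n f \<longleftrightarrow>
     (\<exists>a b. coprime a (int n) \<and> b \<in> Zmod n \<and> (\<forall>x\<in>Zmod n. f x = (a * x + b) mod int n))"

definition similar :: "nat \<Rightarrow> int multiset \<Rightarrow> int multiset \<Rightarrow> bool" where
  "similar n \<gamma> \<delta> \<longleftrightarrow> (\<exists>f. affine_map n f \<and> \<delta> = image_mset f \<gamma>)"

end

theory Submission
  imports Defs
begin

text \<open>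
  Translate so that the most frequent term is \<open>0\<close>, of multiplicity \<open>h\<close>. Then the nonzero terms \<open>T\<close>
  have no zero-sum subsequence of length at least \<open>n - h\<close>: as long as it is longer than \<open>n\<close>, a
  zero-sum subsequence of length at most \<open>h\<close> can be removed from it (a consequence of Scherk's
  addition theorem), after which it can be filled up with zeros. Let \<open>Z\<close> be a longest zero-sum
  subsequence of \<open>T\<close>. Its complement \<open>V\<close> is zero-free of length greater than \<open>n / 2\<close>, so by the
  Savchev-Chen theorem \<open>L(V) < n\<close> after multiplication by a unit. Since no term of \<open>Z\<close> can be
  exchanged for a longer subsequence of \<open>V\<close> with the same sum, \<open>Z\<close> consists of ones and of small
  negative terms; a further exchange shows that \<open>\<alpha>\<close> can be taken to be \<open>V\<close> with the ones of \<open>Z\<close>,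
  and \<open>\<beta>\<close> to be the zeros with the negative terms of \<open>Z\<close>.
\<close>

section \<open>Sums of subsequences modulo \<open>n\<close>\<close>

definition subsums :: "int \<Rightarrow> int multiset \<Rightarrow> int set" where
  "subsums n S = {\<Sum>\<^sub># T mod n |T. T \<subseteq># S}"

definition zero_free :: "int \<Rightarrow> int multiset \<Rightarrow> bool" where
  "zero_free n S \<longleftrightarrow> (\<forall>T. T \<subseteq># S \<longrightarrow> T \<noteq> {#} \<longrightarrow> \<not> n dvd \<Sum>\<^sub># T)"

lemma inj_on_add_mod: "inj_on (\<lambda>s. (s + x) mod n) {0..<n}" for n x :: int
proof (rule inj_onI)
  fix s t :: int assume *: "s \<in> {0..<n}" "t \<in> {0..<n}" "(s + x) mod n = (t + x) mod n"
  then have "[s = t] (mod n)"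
    by (simp add: cong_def[symmetric] cong_add_rcancel)
  with * show "s = t" by (simp add: cong_def)
qed

subsection \<open>Sumsets with a unique representation of zero\<close>

text \<open>Scherk's addition theorem, by induction on \<open>card B\<close>. The last hypothesis
  says that zero has only the trivial representation in the sumset; the Dyson transform keeps this
  property, so the induction runs down to \<open>B = {0}\<close>.\<close>

lemma scherk:
  fixes n :: int
  assumes "0 < n" "A \<subseteq> {0..<n}" "B \<subseteq> {0..<n}" "0 \<in> A" "0 \<in> B"
    and "\<And>a b. a \<in> A \<Longrightarrow> b \<in> B \<Longrightarrow> n dvd a + b \<Longrightarrow> b = 0"
  shows "card A + card B \<le> card ((\<lambda>(a, b). (a + b) mod n) ` (A \<times> B)) + 1"
  using assms(2-)
proof (induction "card B" arbitrary: A B rule: less_induct)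
  case less
  note uniq = less.prems(5)
  have fin: "finite A" "finite B"
    using less.prems(1,2) finite_subset by blast+
  define sms where "sms A B = (\<lambda>(a, b). (a + b) mod n) ` (A \<times> B)" for A B :: "int set"
  have self: "a mod n = a" if "a \<in> A \<or> a \<in> B" for a
    using that less.prems(1,2) by (auto simp: subset_iff)
  show ?case
  proof (cases "B = {0}")
    case True
    have "(\<lambda>(a, b). (a + b) mod n) ` (A \<times> B) = A"
      using True self by (force simp: image_iff)
    then show ?thesis using True by simp
  next
    case False
    with less.prems(4) obtain b where b: "b \<in> B" "b \<noteq> 0" by blast
    \<comment> \<open>If \<open>A\<close> were closed under adding \<open>b\<close>, it would
      contain \<open>(n - 1) * b\<close>, the negative of \<open>b\<close>, and zero would have a
      second representation.\<close>
    have "\<exists>a\<in>A. \<exists>b\<in>B. (a + b) mod n \<notin> A"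
    proof (rule ccontr)
      assume "\<not> ?thesis"
      then have closed: "(a + b) mod n \<in> A" if "a \<in> A" for a using b that by blast
      have "(int k * b) mod n \<in> A" for k
      proof (induction k)
        case (Suc k)
        from closed[OF Suc] show ?case by (simp add: mod_simps algebra_simps)
      qed (use less.prems(3) in simp)
      from this[of "nat (n - 1)"] have "((n - 1) * b) mod n \<in> A" using assms(1) by simp
      moreover have "n dvd ((n - 1) * b) mod n + b"
        by (simp add: dvd_eq_mod_eq_0 mod_simps algebra_simps)
      ultimately show False using uniq b by blast
    qed
    then obtain a b1 where a: "a \<in> A" "b1 \<in> B" "(a + b1) mod n \<notin> A" by blast
    \<comment> \<open>Dyson transform: it keeps the total cardinality, shrinks \<open>B\<close>, and does not enlarge the sumset.\<close>
    define f where "f b = (b + a) mod n" for b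
    define A' where "A' = A \<union> f ` B"
    define B' where "B' = {b \<in> B. f b \<in> A}"
    have inj: "inj_on f B"
      using inj_on_add_mod[of a n] less.prems(2) unfolding f_def by (rule inj_on_subset)
    have frange: "f b \<in> {0..<n}" for b using assms(1) by (simp add: f_def)
    have "B' \<subset> B" using a by (auto simp: B'_def f_def add.commute)
    then have "card B' < card B" using fin psubset_card_mono by blast
    moreover have "A' \<subseteq> {0..<n}" "B' \<subseteq> {0..<n}" "0 \<in> A'" "0 \<in> B'"
      using less.prems(1-4) frange a(1) self by (auto simp: A'_def B'_def f_def)
    moreover have "b' = 0" if ab: "a' \<in> A'" "b' \<in> B'" "n dvd a' + b'" for a' b'
    proof (cases "a' \<in> A")
      case True
      then show ?thesis using uniq that by (auto simp: B'_def)
    next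
      case False
      then obtain b2 where b2: "b2 \<in> B" "a' = f b2" using ab by (auto simp: A'_def)
      have b': "b' \<in> B" "f b' \<in> A" using ab by (auto simp: B'_def)
      \<comment> \<open>The shift by \<open>a\<close> can be moved from \<open>b2\<close> to
        \<open>b'\<close>: modulo \<open>n\<close>, \<open>f b2 + b'\<close> equals
        \<open>f b' + b2\<close>, an element of \<open>A\<close> plus one of \<open>B\<close>. The
        same exchange gives the inclusion of sumsets below.\<close>
      have "n dvd f b' + b2"
        using ab(3) unfolding b2 f_def by (simp add: dvd_eq_mod_eq_0 mod_simps algebra_simps)
      then have "b2 = 0" using uniq b' b2 by blast
      then have "a' = a" using b2 a self by (simp add: f_def)
      then show ?thesis using False a by simp
    qed
    ultimately have "card A' + card B' \<le> card (sms A' B') + 1"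
      unfolding sms_def by (rule less.hyps)
    moreover have "sms A' B' \<subseteq> sms A B"
    proof
      fix s assume "s \<in> sms A' B'"
      then obtain a' b' where s: "a' \<in> A'" "b' \<in> B'" "s = (a' + b') mod n" by (auto simp: sms_def)
      show "s \<in> sms A B"
      proof (cases "a' \<in> A")
        case True
        then show ?thesis using s by (auto simp: sms_def B'_def)
      next
        case False
        then obtain b2 where b2: "b2 \<in> B" "a' = f b2" using s by (auto simp: A'_def)
        have "s = (f b' + b2) mod n"
          unfolding s b2 f_def by (simp add: mod_simps algebra_simps)
        then show ?thesis using s b2 by (auto simp: sms_def B'_def)
      qed
    qed
    then have "card (sms A' B') \<le> card (sms A B)"
      using fin by (intro card_mono) (auto simp: sms_def)
    moreover have "card A' + card B' = card A + card B"
    proof -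
      have "A \<inter> f ` B = f ` B'" by (auto simp: B'_def)
      moreover have "card (f ` B') = card B'"
        using inj by (intro card_image) (auto simp: B'_def inj_on_def)
      moreover have "card (f ` B) = card B" using inj by (rule card_image)
      ultimately show ?thesis
        using card_Un_Int[of A "f ` B"] fin by (simp add: A'_def)
    qed
    ultimately show ?thesis by (simp add: sms_def)
  qed
qed

text \<open>Peeling one copy of each distinct term off \<open>T\<close> lowers all multiplicities by
  one, which drives the induction on \<open>h\<close>. Scherk's theorem combines the peeled set and
  zero with the short sums of the rest; its uniqueness condition is the absence of short zero
  sums.\<close>

lemma card_short_subsums:
  fixes n :: int
  assumes "0 < n" "set_mset T \<subseteq> {0..<n}" "\<And>x. count T x \<le> h"
    and "\<And>W. W \<subseteq># T \<Longrightarrow> W \<noteq> {#} \<Longrightarrow> size W \<le> h \<Longrightarrow> \<not> n dvd \<Sum>\<^sub># W"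
  shows "size T < card {\<Sum>\<^sub># W mod n |W. W \<subseteq># T \<and> size W \<le> h}"
  using assms(2-)
proof (induction h arbitrary: T)
  case 0
  then have "T = {#}" by (simp add: multiset_eq_iff)
  then show ?case by (simp add: conj_commute)
next
  case (Suc h)
  define A where "A = set_mset T"
  define T1 where "T1 = T - mset_set A"
  define X where "X = {\<Sum>\<^sub># W mod n |W. W \<subseteq># T1 \<and> size W \<le> h}"
  define Y where "Y = {\<Sum>\<^sub># W mod n |W. W \<subseteq># T \<and> size W \<le> Suc h}"
  have sub: "mset_set A \<subseteq># T"
    by (simp add: A_def mset_set_set_mset_msubset)
  then have T: "T = T1 + mset_set A" by (simp add: T1_def)
  \<comment> \<open>At most one peeled term is appended, so the length grows by at most one.\<close>
  have XY: "\<exists>V. V \<subseteq># T \<and> size V \<le> Suc h \<and> \<Sum>\<^sub># V = \<Sum>\<^sub># W + b \<and> (b \<noteq> 0 \<longrightarrow> V \<noteq> {#})"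
    if "W \<subseteq># T1" "size W \<le> h" "b \<in> insert 0 A" for W b
  proof (cases "b = 0")
    case True
    then show ?thesis using that T
      by (intro exI[of _ W]) (auto simp: subset_mset.add_increasing2)
  next
    case False
    with that have "{#b#} \<subseteq># mset_set A" by (auto simp: A_def)
    then have "W + {#b#} \<subseteq># T" unfolding T using that subset_mset.add_mono by blast
    then show ?thesis using that by (intro exI[of _ "W + {#b#}"]) auto
  qed
  have "size T1 < card X"
    unfolding X_def
  proof (rule Suc.IH)
    show "set_mset T1 \<subseteq> {0..<n}"
      using Suc.prems(1) unfolding T by auto
    show "count T1 x \<le> h" for x
      using Suc.prems(2)[of x] by (cases "x \<in># T") (auto simp: T1_def A_def not_in_iff)
    show "\<not> n dvd \<Sum>\<^sub># W" if "W \<subseteq># T1" "W \<noteq> {#}" "size W \<le> h" for W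
      using Suc.prems(3)[of W] that T by (auto simp: subset_mset.add_increasing2)
  qed
  moreover have "card X + card (insert 0 A) \<le> card ((\<lambda>(a, b). (a + b) mod n) ` (X \<times> insert 0 A)) + 1"
  proof (rule scherk)
    show "X \<subseteq> {0..<n}" "insert 0 A \<subseteq> {0..<n}"
      using assms(1) Suc.prems(1) by (auto simp: X_def A_def)
    show "0 \<in> X" unfolding X_def by (auto intro!: exI[of _ "{#}"])
    fix a b assume ab: "a \<in> X" "b \<in> insert 0 A" "n dvd a + b"
    then obtain W where W: "W \<subseteq># T1" "size W \<le> h" "a = \<Sum>\<^sub># W mod n" by (auto simp: X_def)
    from XY[OF W(1,2) ab(2)] obtain V where
      V: "V \<subseteq># T" "size V \<le> Suc h" "\<Sum>\<^sub># V = \<Sum>\<^sub># W + b" "b \<noteq> 0 \<longrightarrow> V \<noteq> {#}" by blast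
    have "n dvd \<Sum>\<^sub># V"
      using ab(3) by (simp add: V W dvd_eq_mod_eq_0 mod_simps)
    then show "b = 0" using Suc.prems(3) V by blast
  qed (use assms(1) in auto)
  moreover have "(\<lambda>(a, b). (a + b) mod n) ` (X \<times> insert 0 A) \<subseteq> Y"
  proof clarify
    fix a b assume ab: "a \<in> X" "b \<in> insert 0 A"
    then obtain W where W: "W \<subseteq># T1" "size W \<le> h" "a = \<Sum>\<^sub># W mod n" by (auto simp: X_def)
    from XY[OF W(1,2) ab(2)] show "(a + b) mod n \<in> Y"
      unfolding Y_def W(3) mod_add_left_eq by force
  qed
  moreover have "finite Y"
    by (rule finite_subset[of _ "{0..<n}"]) (use assms(1) in \<open>auto simp: Y_def\<close>)
  moreover have "0 \<notin> A" using Suc.prems(3)[of "{#0#}"] by (auto simp: A_def)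
  moreover have "finite A" by (simp add: A_def)
  moreover have "size T = size T1 + card A" by (subst T) simp
  ultimately show ?case
    unfolding Y_def[symmetric] using card_mono[of Y "(\<lambda>(a, b). (a + b) mod n) ` (X \<times> insert 0 A)"]
    by simp
qed

text \<open>Pigeonhole: without such a \<open>W\<close> there would be more than \<open>n\<close>
  residues modulo \<open>n\<close>.\<close>

lemma short_zero_sum:
  fixes n :: int
  assumes "0 < n" "set_mset T \<subseteq> {0..<n}" "\<And>x. count T x \<le> h" "n \<le> int (size T)"
  obtains W where "W \<subseteq># T" "W \<noteq> {#}" "size W \<le> h" "n dvd \<Sum>\<^sub># W"
proof -
  have "card {\<Sum>\<^sub># W mod n |W. W \<subseteq># T \<and> size W \<le> h} \<le> card {0..<n}"
    using assms(1) by (intro card_mono) auto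
  then show ?thesis
    using card_short_subsums[OF assms(1-3)] assms(1,4) that by fastforce
qed

subsection \<open>Long zero-free sequences\<close>

lemma subsums_add_mset:
  "subsums n (add_mset x S) = subsums n S \<union> (\<lambda>s. (s + x) mod n) ` subsums n S"
proof (intro equalityI subsetI)
  fix s assume "s \<in> subsums n (add_mset x S)"
  then obtain T where T: "T \<subseteq># add_mset x S" "s = \<Sum>\<^sub># T mod n" by (auto simp: subsums_def)
  show "s \<in> subsums n S \<union> (\<lambda>s. (s + x) mod n) ` subsums n S"
  proof (cases "x \<in># T")
    case True
    then obtain U where U: "T = add_mset x U" by (metis insert_DiffM)
    then have "s = (\<Sum>\<^sub># U mod n + x) mod n" using T by (simp add: mod_simps add.commute)
    moreover have "U \<subseteq># S" using T U by simp
    ultimately show ?thesis by (auto simp: subsums_def)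
  next
    case False
    then have "T \<subseteq># S"
      using T(1) subset_eq_diff_conv[of T "{#x#}" S] by (simp add: diff_single_trivial)
    then show ?thesis using T(2) by (auto simp: subsums_def)
  qed
next
  fix s assume "s \<in> subsums n S \<union> (\<lambda>s. (s + x) mod n) ` subsums n S"
  then consider T where "T \<subseteq># S" "s = \<Sum>\<^sub># T mod n"
    | T where "T \<subseteq># S" "s = \<Sum>\<^sub># (add_mset x T) mod n"
    by (auto simp: subsums_def mod_simps add.commute)
  then show "s \<in> subsums n (add_mset x S)"
  proof cases
    case 1
    then have "T \<subseteq># add_mset x S" by (simp add: subset_mset.order_trans[OF _ subset_mset.less_imp_le])
    with 1 show ?thesis by (auto simp: subsums_def)
  next
    case 2
    then have "add_mset x T \<subseteq># add_mset x S" by simp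
    with 2 show ?thesis unfolding subsums_def by blast
  qed
qed

lemma subsums_subset: "0 < n \<Longrightarrow> subsums n S \<subseteq> {0..<n}"
  by (auto simp: subsums_def)

lemma finite_subsums: "0 < n \<Longrightarrow> finite (subsums n S)"
  by (rule finite_subset[OF subsums_subset]) auto

lemma zero_in_subsums: "0 \<in> subsums n S"
  unfolding subsums_def by (auto intro!: exI[of _ "{#}"])

lemma zero_free_add_subsum:
  assumes "zero_free n (add_mset x S)" "s \<in> subsums n S"
  shows "\<not> n dvd s + x"
proof
  assume *: "n dvd s + x"
  from assms obtain T where T: "T \<subseteq># S" "s = \<Sum>\<^sub># T mod n" by (auto simp: subsums_def)
  from * have "n dvd \<Sum>\<^sub># (add_mset x T)"
    unfolding T by (simp add: dvd_eq_mod_eq_0 mod_simps add.commute)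
  moreover have "add_mset x T \<subseteq># add_mset x S" using T by simp
  ultimately show False using assms(1) unfolding zero_free_def by (metis add_mset_not_empty)
qed

text \<open>If removing any term loses only the full sum \<open>\<sigma>\<close> from the set \<open>X\<close> of subsequence sums, then
  every translation by a term maps \<open>X - {\<sigma>}\<close> onto \<open>X - {0}\<close>. Translation by the difference of two
  terms therefore preserves \<open>X - {0}\<close>, which is impossible for distinct terms.\<close>

lemma terms_eq_of_small_increments:
  fixes n :: int
  assumes "0 < n" "zero_free n S" "set_mset S \<subseteq> {0..<n}"
    and incr: "\<And>x. x \<in># S \<Longrightarrow> card (subsums n S) \<le> card (subsums n (S - {#x#})) + 1"
    and "x \<in># S" "y \<in># S"
  shows "x = y"
proof (rule ccontr)
  assume "x \<noteq> y"
  define X where "X = subsums n S"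
  define \<sigma> where "\<sigma> = \<Sum>\<^sub># S mod n"
  have fin: "finite X" and X: "X \<subseteq> {0..<n}" "0 \<in> X" "\<sigma> \<in> X"
    using assms(1) subsums_subset finite_subsums zero_in_subsums
    by (auto simp: X_def \<sigma>_def subsums_def)
  have onto: "(\<lambda>s. (s + x) mod n) ` (X - {\<sigma>}) = X - {0}" if x: "x \<in># S" for x
  proof -
    define R where "R = S - {#x#}"
    have S: "S = add_mset x R" using x by (simp add: R_def)
    \<comment> \<open>If the full sum were already attained by some \<open>T\<close> inside
      \<open>R\<close>, the rest of \<open>S\<close>, which contains \<open>x\<close>, would be a
      nonempty zero-sum subsequence.\<close>
    have "\<sigma> \<notin> subsums n R"
    proof
      assume "\<sigma> \<in> subsums n R"
      then obtain T where T: "T \<subseteq># R" "\<sigma> = \<Sum>\<^sub># T mod n" by (auto simp: subsums_def)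
      then obtain U where U: "R = T + U" by (metis subset_mset.le_iff_add)
      have "n dvd \<Sum>\<^sub># S - \<Sum>\<^sub># T" using T by (simp add: \<sigma>_def mod_eq_dvd_iff)
      then have "n dvd \<Sum>\<^sub># (add_mset x U)" by (simp add: S U)
      moreover have "add_mset x U \<subseteq># S" by (simp add: S U)
      ultimately show False using assms(2) by (auto simp: zero_free_def)
    qed
    moreover have "subsums n R \<subseteq> X" unfolding X_def S subsums_add_mset by blast
    ultimately have "subsums n R \<subseteq> X - {\<sigma>}" by blast
    moreover have "card (X - {\<sigma>}) \<le> card (subsums n R)"
      using incr[OF x] X by (simp add: X_def R_def)
    ultimately have R: "subsums n R = X - {\<sigma>}"
      using fin by (intro card_seteq) auto
    have "(\<lambda>s. (s + x) mod n) ` (X - {\<sigma>}) \<subseteq> X - {0}"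
    proof -
      have "(\<lambda>s. (s + x) mod n) ` (X - {\<sigma>}) \<subseteq> X"
        unfolding R[symmetric] unfolding X_def S subsums_add_mset by blast
      moreover have "\<not> n dvd s + x" if "s \<in> X - {\<sigma>}" for s
        using zero_free_add_subsum[of n x R s] assms(2) that R S by simp
      ultimately show ?thesis by (auto simp: dvd_eq_mod_eq_0)
    qed
    moreover have "card ((\<lambda>s. (s + x) mod n) ` (X - {\<sigma>})) = card (X - {0})"
    proof -
      have "inj_on (\<lambda>s. (s + x) mod n) (X - {\<sigma>})"
        by (rule inj_on_subset[OF inj_on_add_mod]) (use X in auto)
      then show ?thesis using X fin by (simp add: card_image)
    qed
    ultimately show ?thesis using fin by (intro card_subset_eq) auto
  qed
  have shift: "(s + (x - y)) mod n \<in> X - {0}" if "s \<in> X - {0}" for s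
  proof -
    from that onto[OF assms(6)] obtain s' where s': "s' \<in> X - {\<sigma>}" "s = (s' + y) mod n"
      by (metis (no_types, lifting) imageE)
    have "(s + (x - y)) mod n = (s' + x) mod n" unfolding s' mod_add_left_eq by simp
    also have "\<dots> \<in> (\<lambda>s. (s + x) mod n) ` (X - {\<sigma>})" using s'(1) by (rule imageI)
    finally show ?thesis unfolding onto[OF assms(5)] .
  qed
  have "\<sigma> \<noteq> 0" using assms(2,5) by (auto simp: \<sigma>_def zero_free_def dvd_eq_mod_eq_0)
  then have "(0 + x) mod n \<in> (\<lambda>s. (s + x) mod n) ` (X - {\<sigma>})" using X by (intro imageI) auto
  then have "x mod n \<in> X - {0}" unfolding onto[OF assms(5)] by simp
  moreover have xy: "x \<in> {0..<n}" "y \<in> {0..<n}" using assms by auto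
  ultimately have xX: "x \<in> X - {0}" by simp
  \<comment> \<open>\<open>x\<close> lies in the image of the translation by \<open>y\<close>; its
    preimage is the residue of \<open>x - y\<close>, which is nonzero because \<open>x\<close> and
    \<open>y\<close> are distinct residues.\<close>
  have base: "(x - y) mod n \<in> X - {0}"
  proof -
    obtain s where s: "s \<in> X - {\<sigma>}" "x = (s + y) mod n"
      using onto[OF assms(6)] xX by (metis (no_types, lifting) imageE)
    then have "(x - y) mod n = s mod n" by (simp add: mod_diff_left_eq)
    then have "(x - y) mod n = s" using s X by auto
    moreover have "s \<noteq> 0" using s \<open>x \<noteq> y\<close> xy by auto
    ultimately show ?thesis using s by simp
  qed
  \<comment> \<open>For \<open>k = n - 1\<close> this multiple is \<open>n * (x - y)\<close>, which
    is zero modulo \<open>n\<close>.\<close>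
  have "(int (Suc k) * (x - y)) mod n \<in> X - {0}" for k
  proof (induction k)
    case (Suc k)
    from shift[OF this] show ?case
      by (simp only: mod_add_left_eq of_nat_Suc) (simp add: algebra_simps)
  qed (use base in simp)
  from this[of "nat (n - 1)"] show False using assms(1) by simp
qed

text \<open>Savchev-Chen structure theorem for zero-free sequences with few sums, by induction on
  the length. If removing any term loses at most one sum, all terms coincide. Otherwise some removal
  loses at least two sums, so the bound on their number passes to the shorter sequence.\<close>

lemma long_zero_free:
  fixes n :: int
  assumes "0 < n" "zero_free n S" "set_mset S \<subseteq> {0..<n}" "card (subsums n S) < 2 * size S"
  shows "\<exists>g N. S = image_mset (\<lambda>k. (k * g) mod n) N \<and> (\<forall>k\<in>#N. 1 \<le> k) \<and>
    subsums n S = (\<lambda>i. (i * g) mod n) ` {0..\<Sum>\<^sub># N} \<and> (\<forall>i\<in>{1..\<Sum>\<^sub># N}. \<not> n dvd i * g)"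
  using assms(2-)
proof (induction "size S" arbitrary: S)
  case 0
  then show ?case by simp
next
  case (Suc l)
  show ?case
  proof (cases "\<forall>x\<in>#S. card (subsums n S) \<le> card (subsums n (S - {#x#})) + 1")
    case True
    from Suc.hyps(2) have "S \<noteq> {#}" by auto
    then obtain g where g: "g \<in># S" by blast
    have "\<forall>x\<in>#S. x = g"
      using terms_eq_of_small_increments[OF assms(1) Suc.prems(1,2) _ _ g] True by blast
    then have S: "S = replicate_mset (Suc l) g"
      using Suc.hyps(2) set_mset_subset_singletonD[of S g] by auto
    have gr: "g mod n = g" using g Suc.prems(2) by auto
    have "subsums n S = (\<lambda>i. (i * g) mod n) ` {0..int (Suc l)}"
    proof (intro equalityI subsetI)
      fix s assume "s \<in> subsums n S"
      then obtain T where T: "T \<subseteq># S" "s = \<Sum>\<^sub># T mod n" by (auto simp: subsums_def)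
      obtain k where "k \<le> Suc l" "T = replicate_mset k g"
        using T(1) unfolding S by (rule msubseteq_replicate_msetE)
      then show "s \<in> (\<lambda>i. (i * g) mod n) ` {0..int (Suc l)}"
        using T by (auto intro!: image_eqI[of _ _ "int k"])
    next
      fix s assume "s \<in> (\<lambda>i. (i * g) mod n) ` {0..int (Suc l)}"
      then obtain k where k: "k \<in> {0..int (Suc l)}" "s = (k * g) mod n" by blast
      then have "replicate_mset (nat k) g \<subseteq># S"
        unfolding S by (auto simp: subseteq_mset_def)
      then show "s \<in> subsums n S"
        unfolding subsums_def using k by (intro CollectI exI[of _ "replicate_mset (nat k) g"]) simp
    qed
    moreover have "\<not> n dvd i * g" if "i \<in> {1..int (Suc l)}" for i
    proof -
      have "replicate_mset (nat i) g \<subseteq># S" "replicate_mset (nat i) g \<noteq> {#}"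
        using that unfolding S by (auto simp: subseteq_mset_def)
      then have "\<not> n dvd \<Sum>\<^sub># (replicate_mset (nat i) g)"
        using Suc.prems(1) by (auto simp: zero_free_def)
      then show ?thesis using that by simp
    qed
    moreover have "S = image_mset (\<lambda>k. (k * g) mod n) (replicate_mset (Suc l) 1)"
      using S gr by simp
    ultimately show ?thesis
      by (intro exI[of _ g] exI[of _ "replicate_mset (Suc l) 1"]) auto
  next
    case False
    then obtain x where x: "x \<in># S" "card (subsums n (S - {#x#})) + 1 < card (subsums n S)"
      by force
    define R where "R = S - {#x#}"
    have S: "S = add_mset x R" using x by (simp add: R_def)
    have zf: "zero_free n R"
      using Suc.prems(1) unfolding S zero_free_def
      by (metis add_mset_add_single mset_subset_eq_add_left subset_mset.order_trans)
    have "\<exists>g N. R = image_mset (\<lambda>k. (k * g) mod n) N \<and> (\<forall>k\<in>#N. 1 \<le> k) \<and>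
      subsums n R = (\<lambda>i. (i * g) mod n) ` {0..\<Sum>\<^sub># N} \<and> (\<forall>i\<in>{1..\<Sum>\<^sub># N}. \<not> n dvd i * g)"
      using Suc x zf by (intro Suc.hyps(1)) (auto simp: S)
    then obtain g N where N: "R = image_mset (\<lambda>k. (k * g) mod n) N" "\<forall>k\<in>#N. 1 \<le> k"
      "subsums n R = (\<lambda>i. (i * g) mod n) ` {0..\<Sum>\<^sub># N}" "\<forall>i\<in>{1..\<Sum>\<^sub># N}. \<not> n dvd i * g"
      by blast
    define t where "t = \<Sum>\<^sub># N"
    have "int (size N) \<le> t"
      using N(2) unfolding t_def by (induction N) auto
    then have t: "int (size R) \<le> t" using N(1) by simp
    have xr: "x \<in> {0..<n}" using Suc.prems(2) by (simp add: S)
    have zs: "\<not> n dvd i * g + x" if "i \<in> {0..t}" for i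
    proof -
      have "(i * g) mod n \<in> subsums n R" using N(3) that by (simp add: t_def)
      then have "\<not> n dvd (i * g) mod n + x"
        using zero_free_add_subsum Suc.prems(1) S by blast
      then show ?thesis by (simp add: dvd_eq_mod_eq_0 mod_simps)
    qed
    show ?thesis
    \<comment> \<open>With \<open>y\<close> at most \<open>t + 1\<close> the coefficient intervals
      \<open>{0..t}\<close> and \<open>{y..t+y}\<close> leave no gap, so their union is again an
      interval.\<close>
    proof (cases "\<exists>y\<in>{1..t+1}. x = (y * g) mod n")
      case True
      then obtain y where y: "y \<in> {1..t+1}" "x = (y * g) mod n" by blast
      have sum: "(i * g + x) mod n = ((i + y) * g) mod n" for i
        by (simp add: y mod_simps algebra_simps)
      have "subsums n S = (\<lambda>i. (i * g) mod n) ` {0..t} \<union> (\<lambda>i. ((i + y) * g) mod n) ` {0..t}"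
        unfolding S subsums_add_mset N(3) t_def[symmetric] image_image mod_add_left_eq sum ..
      also have "(\<lambda>i. ((i + y) * g) mod n) ` {0..t} = (\<lambda>i. (i * g) mod n) ` {y..t+y}"
        unfolding image_image[of "\<lambda>i. (i * g) mod n" "\<lambda>i. i + y", symmetric]
        by (simp add: image_add_atLeastAtMost' add.commute)
      also have "(\<lambda>i. (i * g) mod n) ` {0..t} \<union> (\<lambda>i. (i * g) mod n) ` {y..t+y} =
          (\<lambda>i. (i * g) mod n) ` {0..t+y}"
        unfolding image_Un[symmetric] using y by (intro arg_cong[of _ _ "image _"]) auto
      finally have "subsums n S = (\<lambda>i. (i * g) mod n) ` {0..t+y}" .
      moreover have "\<not> n dvd i * g" if "i \<in> {1..t+y}" for i
      proof (cases "i \<le> t")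
        case True
        then show ?thesis using N(4) that by (simp add: t_def)
      next
        case False
        then have "\<not> n dvd (i - y) * g + x" using y that by (intro zs) auto
        then show ?thesis using sum[of "i - y"] by (simp add: dvd_eq_mod_eq_0)
      qed
      moreover have "S = image_mset (\<lambda>k. (k * g) mod n) (add_mset y N)"
        using S N y by simp
      ultimately show ?thesis using N(2) y
        by (intro exI[of _ g] exI[of _ "add_mset y N"]) (auto simp: t_def add.commute)
    next
      case False
      \<comment> \<open>A common element would either give \<open>x\<close> the coefficient
        \<open>i - j\<close>, between 1 and \<open>t\<close>, or make \<open>(j - i) * g + x\<close>
        a zero sum. Disjointness doubles the number of sums to \<open>2 * (t + 1)\<close>, at least
        \<open>2 * size S\<close>, which is excluded.\<close>
      have "subsums n R \<inter> (\<lambda>s. (s + x) mod n) ` subsums n R = {}"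
      proof (rule ccontr)
        assume "\<not> ?thesis"
        then obtain i s where ij: "i \<in> {0..t}" "s \<in> subsums n R" "(i * g) mod n = (s + x) mod n"
          unfolding N(3) t_def[symmetric] by blast
        then obtain j where "j \<in> {0..t}" "s = (j * g) mod n"
          unfolding N(3) t_def[symmetric] by blast
        then have ij: "i \<in> {0..t}" "j \<in> {0..t}" "(i * g) mod n = (j * g + x) mod n"
          using ij by (simp_all add: mod_add_left_eq)
        show False
        proof (cases "j < i")
          case True
          have "((i - j) * g) mod n = x mod n"
            using ij(3) by (simp add: mod_eq_dvd_iff algebra_simps)
          then have "x = ((i - j) * g) mod n" using xr by simp
          moreover have "i - j \<in> {1..t+1}" using ij(1,2) True by auto
          ultimately show False using False by blast
        next
          case False
          have "n dvd (j - i) * g + x"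
            using ij(3)[symmetric] by (simp add: mod_eq_dvd_iff algebra_simps)
          then show False using zs[of "j - i"] ij(1,2) False by auto
        qed
      qed
      moreover have "card ((\<lambda>s. (s + x) mod n) ` subsums n R) = card (subsums n R)"
        by (intro card_image inj_on_subset[OF inj_on_add_mod] subsums_subset assms(1))
      ultimately have "card (subsums n S) = 2 * card (subsums n R)"
        unfolding S subsums_add_mset
        by (subst card_Un_disjoint) (auto simp: finite_subsums assms(1))
      moreover have "card (subsums n R) = nat (t + 1)"
      proof -
        have "inj_on (\<lambda>i. (i * g) mod n) {0..t}"
        proof (rule linorder_inj_onI)
          fix i j assume ij: "i < j" "i \<in> {0..t}" "j \<in> {0..t}"
          then have "\<not> n dvd (j - i) * g" using N(4) by (simp add: t_def)
          then show "(i * g) mod n \<noteq> (j * g) mod n"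
            by (metis mod_eq_dvd_iff left_diff_distrib)
        qed auto
        then show ?thesis unfolding N(3) t_def[symmetric] by (simp add: card_image)
      qed
      ultimately show ?thesis using Suc.prems(3) t S by simp
    qed
  qed
qed

subsection \<open>The complement of a longest zero-sum subsequence\<close>

lemma subset_image_msetE:
  assumes "W \<subseteq># image_mset f T"
  obtains U where "U \<subseteq># T" "W = image_mset f U"
proof -
  from assms obtain R where "image_mset f T = W + R" by (metis subset_mset.le_iff_add)
  then obtain U V where "T = U + V" "W = image_mset f U"
    using image_mset_eq_plusD by meson
  with that[of U] show thesis by simp
qed

lemma maximal_submultiset:
  assumes "P {#}"
  obtains I :: "'a multiset" where "I \<subseteq># M" "P I"
    "\<And>J. J \<subseteq># M \<Longrightarrow> P J \<Longrightarrow> size J \<le> size I"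
proof -
  have "\<exists>I. (I \<subseteq># M \<and> P I) \<and> (\<forall>J. J \<subseteq># M \<and> P J \<longrightarrow> size J \<le> size I)"
    by (rule ex_has_greatest_nat[of _ "{#}" _ "Suc (size M)"])
      (use assms in \<open>auto simp: size_mset_mono less_Suc_eq_le\<close>)
  with that show thesis by blast
qed

text \<open>Exchange arguments: no recombination of \<open>V\<close> and \<open>Z\<close> into a
  zero sum may be longer than \<open>Z\<close>. This first forces each term of \<open>Z\<close>
  other than 1 above the sum of \<open>V\<close>, hence into the form \<open>n - m\<close> with
  small \<open>m\<close>. It then bounds the sum of \<open>M\<close>, so that its congruence with
  \<open>p\<close> becomes an equality.\<close>

lemma structure_of_complement:
  fixes n :: int
  assumes V: "\<And>x. x \<in># V \<Longrightarrow> 1 \<le> x" "\<Sum>\<^sub># V < n" "n < 2 * int (size V)"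
    and cover: "\<And>s. s \<in> {0..\<Sum>\<^sub># V} \<Longrightarrow> \<exists>W. W \<subseteq># V \<and> \<Sum>\<^sub># W = s"
    and Z: "\<And>z. z \<in># Z \<Longrightarrow> 0 < z \<and> z < n" "n dvd \<Sum>\<^sub># Z" "int (size Z) < n"
    and max: "\<And>W. W \<subseteq># V + Z \<Longrightarrow> n dvd \<Sum>\<^sub># W \<Longrightarrow> size W \<le> size Z"
  obtains p M where "Z = replicate_mset p 1 + image_mset (\<lambda>m. n - m) M"
    "\<And>m. m \<in># M \<Longrightarrow> 0 < m \<and> m < n" "\<Sum>\<^sub># V + int p < n" "\<Sum>\<^sub># M = int p"
proof -
  define A where "A = \<Sum>\<^sub># V"
  define v where "v = int (size V)"
  define u where "u = count V 1"
  define V2 where "V2 = filter_mset (\<lambda>x. x \<noteq> 1) V"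
  have V_split: "V = replicate_mset u 1 + V2"
    unfolding u_def V2_def by (rule multiset_eqI) simp
  have V2: "2 \<le> x" if "x \<in># V2" for x using V(1)[of x] that by (auto simp: V2_def)
  have A_split: "A = int u + \<Sum>\<^sub># V2" unfolding A_def by (subst V_split) simp
  have v_split: "v = int u + int (size V2)" unfolding v_def by (subst V_split) simp
  have twice: "2 * int (size U) \<le> \<Sum>\<^sub># U" if "U \<subseteq># V2" for U
  proof -
    have "\<And>x. x \<in># U \<Longrightarrow> 2 \<le> x" using V2 mset_subset_eqD[OF that] by simp
    then have "(\<Sum>x\<in>#U. 2) \<le> \<Sum>\<^sub># U" using sum_mset_mono[of U "\<lambda>_. 2" "\<lambda>x. x"] by simp
    then show ?thesis by simp
  qed
  have A: "A < n" "n < 2 * v" using V by (simp_all add: A_def v_def)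
  \<comment> \<open>Terms other than 1 contribute at least 2 each to \<open>A\<close>, so
    \<open>V\<close> has at least \<open>2 * v - A\<close> ones, which is more than
    \<open>n - A\<close>.\<close>
  have u: "2 * v - A \<le> int u" using twice[of V2] A_split v_split by simp
  have le_u: "x \<le> int u" if "x \<in># V" for x
  proof (cases "x = 1")
    case True
    then show ?thesis using that by (simp add: u_def)
  next
    case False
    with that have x: "x \<in># V2" by (simp add: V2_def)
    then have "2 * int (size (V2 - {#x#})) \<le> \<Sum>\<^sub># V2 - x"
      using twice[of "V2 - {#x#}"] by (simp add: sum_mset_diff)
    moreover have "int (size (V2 - {#x#})) = int (size V2) - 1"
      using x size_Suc_Diff1[of x V2] by simp
    ultimately show ?thesis using A A_split v_split by simp
  qed
  have large: "A < z" if z: "z \<in># Z" "z \<noteq> 1" for z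
  proof (rule ccontr)
    assume "\<not> A < z"
    then have zA: "z \<in> {0..A}" using Z(1)[of z] z by simp
    \<comment> \<open>If there are enough ones, \<open>z\<close> of them serve; otherwise any
      representation of \<open>z\<close> has two terms, since by \<open>le_u\<close> no single term
      exceeds \<open>u\<close>.\<close>
    have "\<exists>W. W \<subseteq># V \<and> \<Sum>\<^sub># W = z \<and> 2 \<le> size W"
    proof (cases "z \<le> int u")
      case True
      have "replicate_mset (nat z) 1 \<subseteq># V"
        using True zA unfolding V_split
        by (intro subset_mset.add_increasing2) (auto simp: subseteq_mset_def)
      then show ?thesis using z Z(1)[of z]
        by (intro exI[of _ "replicate_mset (nat z) 1"]) auto
    next
      case False
      obtain W where W: "W \<subseteq># V" "\<Sum>\<^sub># W = z" using cover[of z] zA by (auto simp: A_def)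
      have "size W \<noteq> 0" using W Z(1)[of z] z by auto
      moreover have "size W \<noteq> 1"
      proof
        assume "size W = 1"
        then obtain x where "W = {#x#}" using size_1_singleton_mset by blast
        then show False using W False le_u[of z] by simp
      qed
      ultimately show ?thesis using W by (intro exI[of _ W]) linarith
    qed
    then obtain W where W: "W \<subseteq># V" "\<Sum>\<^sub># W = z" "2 \<le> size W" by blast
    have "W + (Z - {#z#}) \<subseteq># V + Z" using W by (intro subset_mset.add_mono) auto
    moreover have "\<Sum>\<^sub># (W + (Z - {#z#})) = \<Sum>\<^sub># Z" using W z by (simp add: sum_mset_diff)
    ultimately have "size (W + (Z - {#z#})) \<le> size Z" using max[of "W + (Z - {#z#})"] Z(2) by simp
    then show False using W(3) size_Suc_Diff1[OF z(1)] by simp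
  qed
  define p where "p = count Z 1"
  define M where "M = image_mset (\<lambda>z. n - z) (filter_mset (\<lambda>z. z \<noteq> 1) Z)"
  have Z_split: "Z = replicate_mset p 1 + image_mset (\<lambda>m. n - m) M"
    unfolding p_def M_def image_mset.compositionality
    by (rule multiset_eqI) (simp add: comp_def)
  have M: "0 < m \<and> m < n - A" if "m \<in># M" for m
    using that Z(1) large by (auto simp: M_def)
  have sum_neg: "\<Sum>\<^sub># (image_mset (\<lambda>m. n - m) I) = n * int (size I) - \<Sum>\<^sub># I" for I
    by (induction I) (simp_all add: algebra_simps)
  have size_Z: "size Z = p + size M" by (subst Z_split) simp
  have "n dvd int p + n * int (size M) - \<Sum>\<^sub># M"
  proof -
    have "\<Sum>\<^sub># Z = int p + n * int (size M) - \<Sum>\<^sub># M"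
      by (subst Z_split) (simp add: sum_neg)
    with Z(2) show ?thesis by simp
  qed
  then have "n dvd (int p + n * int (size M) - \<Sum>\<^sub># M) - n * int (size M)"
    by (rule dvd_diff) simp
  then have cong: "n dvd int p - \<Sum>\<^sub># M" by simp
  have M_nonneg: "0 \<le> \<Sum>\<^sub># M"
    using sum_mset_mono[of M "\<lambda>_. 0" "\<lambda>m. m"] M by force
  have balance: "\<Sum>\<^sub># M + A < n"
  proof (rule ccontr)
    assume "\<not> \<Sum>\<^sub># M + A < n"
    \<comment> \<open>All ones of \<open>Z\<close>, all of \<open>V\<close> except \<open>e\<close> ones, and the negatives of a maximal \<open>I\<close> of sum at
      most \<open>R\<close> form a zero-sum sequence that turns out to be longer than \<open>Z\<close>.\<close>
    define R where "R = \<Sum>\<^sub># M + A - n"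
    have "0 \<le> R" using \<open>\<not> \<Sum>\<^sub># M + A < n\<close> by (simp add: R_def)
    then obtain I where I: "I \<subseteq># M" "\<Sum>\<^sub># I \<le> R"
      "\<And>J. J \<subseteq># M \<Longrightarrow> \<Sum>\<^sub># J \<le> R \<Longrightarrow> size J \<le> size I"
      using maximal_submultiset[of "\<lambda>I. \<Sum>\<^sub># I \<le> R" M] by auto
    define J where "J = M - I"
    have M_IJ: "M = I + J" using I(1) by (simp add: J_def)
    \<comment> \<open>Chosen so that \<open>A - e\<close> minus the sum of \<open>I\<close> equals
      \<open>n\<close> minus the sum of \<open>M\<close>; with \<open>cong\<close> this makes the
      sum of \<open>W\<close> below divisible by \<open>n\<close>.\<close>
    define e where "e = R - \<Sum>\<^sub># I"
    have "0 \<le> e" using I(2) by (simp add: e_def)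
    have J_sum: "\<Sum>\<^sub># J = n - A + e" by (simp add: e_def R_def M_IJ)
    have J_gt: "e < m" if "m \<in># J" for m
    proof (rule ccontr)
      assume "\<not> e < m"
      then have "\<Sum>\<^sub># (add_mset m I) \<le> R" by (simp add: e_def)
      moreover have "add_mset m I \<subseteq># M"
        using that unfolding M_IJ by simp
      ultimately show False using I(3)[of "add_mset m I"] by simp
    qed
    have "\<And>m. m \<in># J \<Longrightarrow> e + 1 \<le> m" using J_gt by fastforce
    then have "(\<Sum>m\<in>#J. e + 1) \<le> \<Sum>\<^sub># J"
      using sum_mset_mono[of J "\<lambda>_. e + 1" "\<lambda>m. m"] by simp
    then have J_size: "(e + 1) * int (size J) \<le> n - A + e"
      unfolding J_sum by (simp add: mult.commute)
    have "J \<noteq> {#}" using J_sum A \<open>0 \<le> e\<close> by auto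
    then obtain m where "m \<in># J" by blast
    \<comment> \<open>Here \<open>e < m < n - A\<close>, while there are more than
      \<open>n - A\<close> ones, so \<open>e\<close> of them can indeed be dropped.\<close>
    then have "e < n - A - 1" using J_gt[of m] M[of m] by (simp add: M_IJ)
    moreover have "n - A + 1 \<le> v" using u v_split A by linarith
    ultimately have eu: "e \<le> int u" using u A by linarith
    define W where "W = replicate_mset p 1 + (replicate_mset (u - nat e) 1 + V2) +
      image_mset (\<lambda>m. n - m) I"
    have "W \<subseteq># V + Z"
    proof -
      have "replicate_mset (u - nat e) 1 + V2 \<subseteq># V"
        unfolding V_split by (auto simp: subseteq_mset_def)
      moreover have "replicate_mset p 1 + image_mset (\<lambda>m. n - m) I \<subseteq># Z"
        unfolding Z_split using I(1) by (intro subset_mset.add_mono image_mset_subseteq_mono) auto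
      ultimately have "(replicate_mset (u - nat e) 1 + V2) +
          (replicate_mset p 1 + image_mset (\<lambda>m. n - m) I) \<subseteq># V + Z"
        by (rule subset_mset.add_mono)
      then show ?thesis by (simp add: W_def ac_simps)
    qed
    moreover have "n dvd \<Sum>\<^sub># W"
    proof -
      have "\<Sum>\<^sub># W = int p + (A - e) + n * int (size I) - \<Sum>\<^sub># I"
        using eu \<open>0 \<le> e\<close> by (simp add: W_def sum_neg A_split of_nat_diff)
      also have "\<dots> = (int p - \<Sum>\<^sub># M) + n * (int (size I) + 1)"
        by (simp add: e_def R_def algebra_simps)
      finally show ?thesis using cong by simp
    qed
    ultimately have "size W \<le> size Z" by (rule max)
    then have "v - e \<le> int (size J)"
      using eu \<open>0 \<le> e\<close> by (simp add: W_def size_Z M_IJ v_split)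
    \<comment> \<open>\<open>J\<close> has at least \<open>v - e\<close> terms, each at least
      \<open>e + 1\<close>, but its sum is only \<open>n - A + e\<close>. As \<open>v\<close> is at
      least \<open>n - A + 1\<close>, this would make \<open>e * (n - A - 1 - e) + 1\<close>
      nonpositive.\<close>
    then have "(e + 1) * (v - e) \<le> n - A + e"
      using J_size \<open>0 \<le> e\<close> by (meson mult_left_mono order_trans zle_add1_eq_le le_less add_nonneg_nonneg zero_le_one)
    moreover have "(e + 1) * (n - A + 1 - e) \<le> (e + 1) * (v - e)"
      using \<open>n - A + 1 \<le> v\<close> \<open>0 \<le> e\<close> by (intro mult_left_mono) auto
    ultimately have "e * (n - A - 1 - e) + 1 \<le> 0" by (simp add: algebra_simps)
    moreover have "0 \<le> e * (n - A - 1 - e)"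
      using \<open>0 \<le> e\<close> \<open>e < n - A - 1\<close> by (intro mult_nonneg_nonneg) auto
    ultimately show False by simp
  qed
  have "\<Sum>\<^sub># M = int p"
  proof -
    have "0 \<le> A" using A_split twice[of V2] by simp
    then have "\<bar>int p - \<Sum>\<^sub># M\<bar> < n"
      using balance M_nonneg Z(3) size_Z by simp
    then show ?thesis using cong dvd_imp_le_int[of "int p - \<Sum>\<^sub># M" n] by fastforce
  qed
  moreover have "0 < m \<and> m < n" if "m \<in># M" for m
    using M[OF that] A_split twice[of V2] by simp
  ultimately show thesis
    using that[OF Z_split] balance by (simp add: A_def)
qed

subsection \<open>Least positive representatives\<close>

lemma least_pos_rep_props:
  assumes "1 \<le> n"
  shows "1 \<le> least_pos_rep n a" "least_pos_rep n a \<le> int n" "[least_pos_rep n a = a] (mod int n)"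
  using theI'[OF least_pos_rep_ex1[OF assms, of a]] unfolding least_pos_rep_def[symmetric] by simp_all

lemma least_pos_rep_eq:
  assumes "1 \<le> k" "k \<le> int n" "[k = a] (mod int n)"
  shows "least_pos_rep n a = k"
  unfolding least_pos_rep_def
  by (rule the1_equality[OF least_pos_rep_ex1]) (use assms in auto)

lemma L_union: "L n (\<alpha> + \<beta>) = L n \<alpha> + L n \<beta>"
  by (simp add: L_def)

lemma L_ge_size:
  assumes "1 \<le> n"
  shows "int (size \<omega>) \<le> L n \<omega>"
  using sum_mset_mono[of \<omega> "\<lambda>_. 1" "least_pos_rep n"] least_pos_rep_props(1)[OF assms]
  by (simp add: L_def)

lemma L_mono:
  assumes "1 \<le> n" "\<alpha> \<subseteq># \<beta>"
  shows "L n \<alpha> \<le> L n \<beta>"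
proof -
  obtain \<rho> where "\<beta> = \<alpha> + \<rho>" using assms(2) by (metis subset_mset.le_iff_add)
  then show ?thesis using L_ge_size[OF assms(1), of \<rho>] by (simp add: L_union)
qed

lemma L_cong:
  assumes "1 \<le> n"
  shows "[L n \<omega> = \<Sum>\<^sub># \<omega>] (mod int n)"
  by (induction \<omega>) (use assms in \<open>auto simp: L_def intro!: cong_add least_pos_rep_props(3)\<close>)

lemma one_minus_cong: "[\<Sum>\<^sub># (one_minus n \<beta>) = int (size \<beta>) - \<Sum>\<^sub># \<beta>] (mod int n)"
proof (induction \<beta>)
  case (add b \<beta>)
  have "[(1 - b) mod int n + \<Sum>\<^sub># (one_minus n \<beta>) = (1 - b) + (int (size \<beta>) - \<Sum>\<^sub># \<beta>)] (mod int n)"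
    using add by (intro cong_add) simp_all
  then show ?case by (simp add: one_minus_def algebra_simps)
qed (simp add: one_minus_def)

text \<open>Split \<open>\<delta>\<close> between \<open>\<alpha>\<close> and
  \<open>\<beta>\<close>: the two bounds on \<open>L\<close> trap an integer congruent to its sum
  strictly between 0 and \<open>n\<close>.\<close>

lemma union_no_zero_sum:
  assumes n: "1 \<le> n" and "L n \<alpha> < int n" "L n (one_minus n \<beta>) < int n"
    and "\<delta> \<subseteq># \<alpha> + \<beta>" "size \<delta> = n"
  shows "\<not> int n dvd \<Sum>\<^sub># \<delta>"
proof
  assume zero: "int n dvd \<Sum>\<^sub># \<delta>"
  define \<alpha>' \<beta>' where "\<alpha>' = \<delta> \<inter># \<alpha>" and "\<beta>' = \<delta> - \<alpha>"
  have \<delta>: "\<delta> = \<alpha>' + \<beta>'"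
    by (rule multiset_eqI) (simp add: \<alpha>'_def \<beta>'_def)
  have "\<beta>' \<subseteq># \<beta>" using assms(4) by (simp add: \<beta>'_def subset_eq_diff_conv add.commute)
  then have "one_minus n \<beta>' \<subseteq># one_minus n \<beta>"
    unfolding one_minus_def by (rule image_mset_subseteq_mono)
  then have \<beta>'_bounds: "int (size \<beta>') \<le> L n (one_minus n \<beta>')" "L n (one_minus n \<beta>') < int n"
    using L_ge_size[OF n, of "one_minus n \<beta>'"] L_mono[OF n] assms(3)
    by (fastforce simp: one_minus_def)+
  have "L n \<alpha>' \<le> L n \<alpha>" by (rule L_mono[OF n]) (simp add: \<alpha>'_def)
  then have \<alpha>'_bounds: "int (size \<alpha>') \<le> L n \<alpha>'" "L n \<alpha>' < int n"
    using L_ge_size[OF n, of \<alpha>'] assms(2) by simp_all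
  \<comment> \<open>Modulo \<open>n\<close>, the bracket is the sum of \<open>\<beta>'\<close>. As
    the lengths add up to \<open>n\<close> and \<open>L\<close> is at least the length,
    \<open>D\<close> lies between \<open>n - L n (one_minus n \<beta>')\<close> and
    \<open>L n \<alpha>'\<close>.\<close>
  define D where "D = L n \<alpha>' + (int (size \<beta>') - L n (one_minus n \<beta>'))"
  have "[L n (one_minus n \<beta>') = int (size \<beta>') - \<Sum>\<^sub># \<beta>'] (mod int n)"
    using L_cong[OF n] one_minus_cong by (rule cong_trans)
  then have "[D = \<Sum>\<^sub># \<alpha>' + (int (size \<beta>') - (int (size \<beta>') - \<Sum>\<^sub># \<beta>'))] (mod int n)"
    unfolding D_def by (intro cong_add cong_diff cong_refl L_cong[OF n])
  then have "[D = \<Sum>\<^sub># \<delta>] (mod int n)" by (simp add: \<delta>)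
  then have "int n dvd D" using zero cong_dvd_iff by blast
  moreover have "0 < D" "D < int n"
    using \<alpha>'_bounds \<beta>'_bounds assms(5) by (simp_all add: D_def \<delta>)
  ultimately show False using zdvd_not_zless by blast
qed

subsection \<open>Affine maps\<close>

lemma sum_image_affine_cong:
  "[\<Sum>\<^sub># (image_mset (\<lambda>x. (c * x + b) mod n) U) = c * \<Sum>\<^sub># U + int (size U) * b] (mod n)"
  for n :: int
proof (induction U)
  case (add u U)
  have "[(c * u + b) mod n + \<Sum>\<^sub># (image_mset (\<lambda>x. (c * x + b) mod n) U) =
      (c * u + b) + (c * \<Sum>\<^sub># U + int (size U) * b)] (mod n)"
    using add by (intro cong_add) simp_all
  then show ?case by (simp add: algebra_simps)
qed simp

text \<open>As \<open>c\<close> is a unit, only the total translation \<open>size U * b\<close>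
  could matter. The second hypothesis covers both uses: length \<open>n\<close> with any
  \<open>b\<close>, and any length with \<open>b = 0\<close>.\<close>

lemma dvd_sum_image_affine:
  fixes n :: int
  assumes "coprime c n" "n dvd int (size U) * b"
  shows "n dvd \<Sum>\<^sub># (image_mset (\<lambda>x. (c * x + b) mod n) U) \<longleftrightarrow> n dvd \<Sum>\<^sub># U"
proof -
  have "n dvd \<Sum>\<^sub># (image_mset (\<lambda>x. (c * x + b) mod n) U) \<longleftrightarrow> n dvd c * \<Sum>\<^sub># U + int (size U) * b"
    by (rule cong_dvd_iff[OF sum_image_affine_cong])
  also have "\<dots> \<longleftrightarrow> n dvd c * \<Sum>\<^sub># U" using assms(2) by (simp add: dvd_add_left_iff)
  also have "\<dots> \<longleftrightarrow> n dvd \<Sum>\<^sub># U"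
    using assms(1) by (simp add: coprime_dvd_mult_right_iff coprime_commute)
  finally show ?thesis .
qed

subsection \<open>Sequences without zero-sum subsequences of length n\<close>

text \<open>If \<open>W\<close> has at most \<open>n\<close> terms and the bound fails, zeros pad it
  to length exactly \<open>n\<close>. If \<open>W\<close> is longer, removing a zero sum of length
  at most \<open>h\<close> leaves one bounded by induction, so \<open>W\<close> would have fewer
  than \<open>n\<close> terms after all.\<close>

lemma zero_sum_length_bound:
  assumes n: "1 \<le> n" and T: "set_mset T \<subseteq> {0..<int n}" "\<And>x. count T x \<le> h"
    and nz: "\<And>W. W \<subseteq># replicate_mset h 0 + T \<Longrightarrow> size W = n \<Longrightarrow> \<not> int n dvd \<Sum>\<^sub># W"
    and "W \<subseteq># T" "int n dvd \<Sum>\<^sub># W"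
  shows "size W + h < n"
  using assms(5,6)
proof (induction "size W" arbitrary: W rule: less_induct)
  case less
  show ?case
  proof (cases "size W \<le> n")
    case True
    show ?thesis
    proof (rule ccontr)
      assume "\<not> size W + h < n"
      then have "replicate_mset (n - size W) 0 + W \<subseteq># replicate_mset h 0 + T"
        using less.prems(1) by (intro subset_mset.add_mono) (auto simp: subseteq_mset_def)
      from nz[OF this] show False using True less.prems(2) by simp
    qed
  next
    case False
    have "set_mset W \<subseteq> {0..<int n}" "\<And>x. count W x \<le> h"
      using T less.prems(1) set_mset_mono subseteq_mset_def order_trans by (blast, metis)
    then obtain U where U: "U \<subseteq># W" "U \<noteq> {#}" "size U \<le> h" "int n dvd \<Sum>\<^sub># U"
      using short_zero_sum[of "int n" W h] n False by auto
    define R where "R = W - U"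
    have W: "W = U + R" using U(1) by (simp add: R_def)
    have "size R + h < n"
    proof (rule less.hyps)
      show "size R < size W" using U(2) by (simp add: W nonempty_has_size)
      have "R \<subseteq># W" by (simp add: W)
      then show "R \<subseteq># T" using less.prems(1) by (rule subset_mset.order_trans)
      show "int n dvd \<Sum>\<^sub># R" using less.prems(2) U(4) by (simp add: W dvd_add_right_iff)
    qed
    then show ?thesis using False U(3) W by simp
  qed
qed

lemma most_frequent_element:
  assumes "S \<noteq> {#}"
  obtains a where "a \<in># S" "\<And>x. count S x \<le> count S a"
proof -
  obtain b where "b \<in># S" using assms by blast
  then have "\<exists>a. a \<in># S \<and> (\<forall>x. x \<in># S \<longrightarrow> count S x \<le> count S a)"
    by (rule ex_has_greatest_nat[of _ _ _ "Suc (size S)"]) (simp add: less_Suc_eq_le count_le_size)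
  then show thesis using that by (metis count_eq_zero_iff le0)
qed

lemma sum_mset_pos_bounds:
  fixes N :: "int multiset"
  assumes "\<And>k. k \<in># N \<Longrightarrow> 1 \<le> k" "U \<subseteq># N"
  shows "int (size U) \<le> \<Sum>\<^sub># U" "\<Sum>\<^sub># U \<le> \<Sum>\<^sub># N"
proof -
  obtain R where N: "N = U + R" using assms(2) by (metis subset_mset.le_iff_add)
  have *: "int (size V) \<le> \<Sum>\<^sub># V" if "\<And>k. k \<in># V \<Longrightarrow> 1 \<le> k" for V :: "int multiset"
    using sum_mset_mono[of V "\<lambda>_. 1" "\<lambda>k. k"] that by simp
  from *[of U] assms(1) show "int (size U) \<le> \<Sum>\<^sub># U" by (simp add: N)
  from *[of R] assms(1) show "\<Sum>\<^sub># U \<le> \<Sum>\<^sub># N" by (simp add: N)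
qed

text \<open>The required affine map is composed of the subtraction of the most frequent term and the
  multiplication by the inverse of \<open>g\<close>. The length bound is
  \<open>size \<gamma> > 3 * n / 2 - 1\<close> cleared of fractions.\<close>

lemma no_zero_sum_structure:
  assumes n: "1 \<le> n" and \<gamma>: "seq_in_Zmod n \<gamma>" and long: "3 * n < 2 * size \<gamma> + 2"
    and nz: "\<And>\<delta>. \<delta> \<subseteq># \<gamma> \<Longrightarrow> size \<delta> = n \<Longrightarrow> \<not> int n dvd \<Sum>\<^sub># \<delta>"
  shows "\<exists>\<alpha> \<beta>. seq_in_Zmod n \<alpha> \<and> seq_in_Zmod n \<beta> \<and> similar n \<gamma> (\<alpha> + \<beta>) \<and>
      L n \<alpha> < int n \<and> L n (one_minus n \<beta>) < int n"
proof -
  define m where "m = int n"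
  have m: "0 < m" using n by (simp add: m_def)
  have "\<gamma> \<noteq> {#}" using n long by auto
  then obtain a where a: "a \<in># \<gamma>" "\<And>x. count \<gamma> x \<le> count \<gamma> a"
    using most_frequent_element by blast
  define h where "h = count \<gamma> a"
  define \<tau> where "\<tau> x = (x - a) mod m" for x
  define \<gamma>' where "\<gamma>' = filter_mset (\<lambda>x. x \<noteq> a) \<gamma>"
  define T where "T = image_mset \<tau> \<gamma>'"
  have \<gamma>_split: "\<gamma> = replicate_mset h a + \<gamma>'"
    unfolding h_def \<gamma>'_def by (rule multiset_eqI) simp
  have residue: "x \<in> {0..<m}" if "x \<in># \<gamma>" for x
    using \<gamma> that by (auto simp: seq_in_Zmod_def Zmod_def m_def)
  have T_range: "0 < y \<and> y < m" if "y \<in># T" for y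
  proof -
    from that obtain x where x: "x \<in># \<gamma>" "x \<noteq> a" "y = \<tau> x" by (auto simp: T_def \<gamma>'_def)
    have "\<not> m dvd x - a"
      using residue[OF x(1)] residue[OF a(1)] x(2) zdvd_imp_le[of m "x - a"]
        dvd_imp_le_int[of "x - a" m] by auto
    then have "y \<noteq> 0" by (simp add: x \<tau>_def dvd_eq_mod_eq_0)
    moreover have "0 \<le> y" "y < m" using m by (simp_all add: x \<tau>_def)
    ultimately show ?thesis by simp
  qed
  have T_count: "count T y \<le> h" for y
  proof -
    \<comment> \<open>Translation is injective on residues, so multiplicities in \<open>T\<close>
      are those of single terms of \<open>\<gamma>\<close>.\<close>
    have "\<tau> -` {y} \<inter> set_mset \<gamma>' \<subseteq> {(y + a) mod m}"
    proof
      fix x assume x: "x \<in> \<tau> -` {y} \<inter> set_mset \<gamma>'"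
      then have "(y + a) mod m = x mod m" by (auto simp: \<tau>_def mod_simps)
      moreover have "x mod m = x" using x residue[of x] by (auto simp: \<gamma>'_def)
      ultimately show "x \<in> {(y + a) mod m}" by simp
    qed
    then have "count T y \<le> (\<Sum>x\<in>{(y + a) mod m}. count \<gamma>' x)"
      unfolding T_def count_image_mset by (intro sum_mono2) auto
    also have "\<dots> \<le> h" using a(2) by (simp add: h_def \<gamma>'_def)
    finally show ?thesis .
  qed
  have T_bound: "size W + h < n" if "W \<subseteq># T" "m dvd \<Sum>\<^sub># W" for W
  proof (rule zero_sum_length_bound)
    show "set_mset T \<subseteq> {0..<int n}" using T_range by (fastforce simp: m_def)
    fix U assume U: "U \<subseteq># replicate_mset h 0 + T" "size U = n"
    have "replicate_mset h 0 + T = image_mset \<tau> \<gamma>"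
      by (subst \<gamma>_split) (simp add: T_def \<tau>_def)
    then obtain V where V: "V \<subseteq># \<gamma>" "U = image_mset (\<lambda>x. (1 * x + - a) mod m) V"
      using U(1) subset_image_msetE[of U \<tau> \<gamma>] unfolding \<tau>_def by auto
    \<comment> \<open>For length \<open>n\<close> the translation changes the sum by a multiple of
      \<open>n\<close>.\<close>
    then have "size V = n" using U(2) by simp
    then show "\<not> int n dvd \<Sum>\<^sub># U"
      using nz[OF V(1)] dvd_sum_image_affine[of 1 m V "- a"] unfolding V(2) by (simp add: m_def)
  qed (use n T_count that in \<open>simp_all add: m_def\<close>)
  obtain Z where Z: "Z \<subseteq># T" "m dvd \<Sum>\<^sub># Z"
    "\<And>W. W \<subseteq># T \<Longrightarrow> m dvd \<Sum>\<^sub># W \<Longrightarrow> size W \<le> size Z"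
    using maximal_submultiset[of "\<lambda>W. m dvd \<Sum>\<^sub># W" T] by auto
  define V where "V = T - Z"
  have T_VZ: "T = V + Z" using Z(1) by (simp add: V_def)
  have Z_size: "size Z + h < n" by (rule T_bound[OF Z(1,2)])
  have "size \<gamma> = h + size T" by (subst \<gamma>_split) (simp add: T_def)
  \<comment> \<open>\<open>size V\<close> is \<open>size \<gamma> - (size Z + h)\<close>, which
    exceeds \<open>(3 * n / 2 - 1) - (n - 1) = n / 2\<close>.\<close>
  then have V_size: "n < 2 * size V" using long Z_size T_VZ by simp
  have "zero_free m V"
    unfolding zero_free_def
  proof (intro allI impI notI)
    fix W assume W: "W \<subseteq># V" "W \<noteq> {#}" "m dvd \<Sum>\<^sub># W"
    have "W + Z \<subseteq># T" using W(1) by (simp add: T_VZ)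
    moreover have "m dvd \<Sum>\<^sub># (W + Z)" using W(3) Z(2) by simp
    ultimately have "size (W + Z) \<le> size Z" by (rule Z(3))
    then show False using W(2) by (simp add: nonempty_has_size)
  qed
  moreover have "set_mset V \<subseteq> {0..<m}" using T_range by (fastforce simp: T_VZ)
  moreover have "card (subsums m V) < 2 * size V"
    using card_mono[OF _ subsums_subset[OF m, of V]] V_size by (simp add: m_def)
  ultimately have "\<exists>g N. V = image_mset (\<lambda>k. (k * g) mod m) N \<and> (\<forall>k\<in>#N. 1 \<le> k) \<and>
    subsums m V = (\<lambda>i. (i * g) mod m) ` {0..\<Sum>\<^sub># N} \<and> (\<forall>i\<in>{1..\<Sum>\<^sub># N}. \<not> m dvd i * g)"
    by (rule long_zero_free[OF m])
  then obtain g N where V_eq: "V = image_mset (\<lambda>k. (k * g) mod m) N" and pos: "\<forall>k\<in>#N. 1 \<le> k"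
    and sub_eq: "subsums m V = (\<lambda>i. (i * g) mod m) ` {0..\<Sum>\<^sub># N}"
    and ndvd: "\<forall>i\<in>{1..\<Sum>\<^sub># N}. \<not> m dvd i * g"
    by (elim exE conjE) (rule that)
  note N = V_eq bspec[OF pos] sub_eq bspec[OF ndvd]
  define t where "t = \<Sum>\<^sub># N"
  have N_size: "size N = size V" by (simp add: N(1))
  \<comment> \<open>\<open>t < m\<close> holds because \<open>m * g\<close> is zero modulo
    \<open>m\<close>, so \<open>m\<close> is not in \<open>{1..t}\<close>.\<close>
  have t: "int (size V) \<le> t" "t < m"
    using sum_mset_pos_bounds(1)[of N N] N(2) N_size N(4)[of m] m by (force simp: t_def)+
  have V_pos: "1 \<le> int (size V)" using V_size by simp
  have N_le: "k \<le> t" if "k \<in># N" for k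
    using sum_mset_pos_bounds(2)[of N "{#k#}"] N(2) that by (simp add: t_def)
  have "coprime g m"
  proof -
    define d where "d = gcd g m"
    define k where "k = m div d"
    have d: "0 < d" "m = k * d" using m by (simp_all add: d_def k_def)
    then have "0 < k" using m by (simp add: zero_less_mult_iff)
    \<comment> \<open>\<open>k * g\<close> vanishes modulo \<open>m\<close>, so \<open>k\<close>
      exceeds \<open>t\<close>, hence \<open>m / 2\<close>; this leaves only
      \<open>d = 1\<close>.\<close>
    have "m dvd k * g" unfolding d(2) by (rule mult_dvd_mono) (simp_all add: d_def)
    then have "t < k" using N(4)[of k] \<open>0 < k\<close> by (force simp: t_def)
    then have "m < 2 * k" using t V_size by (simp add: m_def)
    then have "d < 2" unfolding d(2) using \<open>0 < k\<close> by (simp add: mult.commute)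
    then have "gcd g m = 1" using d(1) unfolding d_def by linarith
    then show ?thesis by (rule gcd_eq_1_imp_coprime)
  qed
  then have "\<exists>g'. [g * g' = 1] (mod m)" by (rule cong_solve_coprime_int)
  then obtain g' where g': "[g * g' = 1] (mod m)" ..
  then have "coprime g' m" by (metis coprime_iff_invertible_int mult.commute)
  \<comment> \<open>Multiplication by the inverse of \<open>g\<close>, which recovers the
    coefficients \<open>N\<close> from \<open>V\<close>; the \<open>+ 0\<close> fits the affine
    lemmas.\<close>
  define \<phi> where "\<phi> x = (g' * x + 0) mod m" for x
  have \<phi>_dvd: "m dvd \<Sum>\<^sub># (image_mset \<phi> U) \<longleftrightarrow> m dvd \<Sum>\<^sub># U" for U
    unfolding \<phi>_def using \<open>coprime g' m\<close> by (intro dvd_sum_image_affine) auto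
  have \<phi>_mult: "\<phi> ((k * g) mod m) = k mod m" for k
  proof -
    have "[k * (g * g') = k * 1] (mod m)" by (intro cong_mult cong_refl g')
    then show ?thesis by (simp add: \<phi>_def cong_def mod_simps algebra_simps)
  qed
  have \<phi>_V: "image_mset \<phi> V = N"
  proof -
    have "image_mset \<phi> V = image_mset (\<lambda>k. k) N"
      unfolding N(1) image_mset.compositionality
      by (intro image_mset_cong) (use N(2) N_le t(2) \<phi>_mult in fastforce)
    then show ?thesis by simp
  qed
  define Z' where "Z' = image_mset \<phi> Z"
  have \<phi>_T: "image_mset \<phi> T = N + Z'" by (simp add: T_VZ \<phi>_V Z'_def)
  obtain p M where M: "Z' = replicate_mset p 1 + image_mset (\<lambda>x. m - x) M"
    "\<And>x. x \<in># M \<Longrightarrow> 0 < x \<and> x < m" "\<Sum>\<^sub># N + int p < m" "\<Sum>\<^sub># M = int p"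
  proof (rule structure_of_complement[of N m Z'])
    show "1 \<le> k" if "k \<in># N" for k using N(2) that .
    show "\<Sum>\<^sub># N < m" using t by (simp add: t_def)
    show "m < 2 * int (size N)" using V_size by (simp add: m_def N_size)
    show "int (size Z') < m" using Z_size by (simp add: Z'_def m_def)
    show "m dvd \<Sum>\<^sub># Z'" using Z(2) by (simp add: Z'_def \<phi>_dvd)
  next
    fix z assume "z \<in># Z'"
    then obtain y where y: "y \<in># Z" "z = \<phi> y" by (auto simp: Z'_def)
    then have "0 < y \<and> y < m" using T_range by (simp add: T_VZ)
    then have "\<not> m dvd y" using zdvd_not_zless by blast
    then have "\<not> m dvd z" using \<phi>_dvd[of "{#y#}"] by (simp add: y)
    then have "z \<noteq> 0" by auto
    moreover have "0 \<le> z" "z < m" using m by (simp_all add: y \<phi>_def)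
    ultimately show "0 < z \<and> z < m" by simp
  next
    fix s assume s: "s \<in> {0..\<Sum>\<^sub># N}"
    \<comment> \<open>The subsequence of \<open>V\<close> with sum \<open>s * g\<close> becomes one
      of \<open>N\<close> with sum congruent to \<open>s\<close>; both numbers lie in
      \<open>[0, m)\<close>, so they are equal as integers.\<close>
    then have "(s * g) mod m \<in> subsums m V" unfolding N(3) by blast
    then obtain W where W: "W \<subseteq># V" "(s * g) mod m = \<Sum>\<^sub># W mod m"
      by (auto simp: subsums_def)
    have sub: "image_mset \<phi> W \<subseteq># N"
      unfolding \<phi>_V[symmetric] using W(1) by (rule image_mset_subseteq_mono)
    have "[\<Sum>\<^sub># (image_mset \<phi> W) = g' * \<Sum>\<^sub># W + int (size W) * 0] (mod m)"
      unfolding \<phi>_def by (rule sum_image_affine_cong)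
    then have "\<Sum>\<^sub># (image_mset \<phi> W) mod m = \<phi> (\<Sum>\<^sub># W mod m)"
      by (simp add: \<phi>_def cong_def mod_simps)
    also have "\<dots> = s mod m" unfolding W(2)[symmetric] by (rule \<phi>_mult)
    also have "\<dots> = s" using s t by (simp add: t_def)
    finally have "\<Sum>\<^sub># (image_mset \<phi> W) mod m = s" .
    moreover have "0 \<le> \<Sum>\<^sub># (image_mset \<phi> W)" "\<Sum>\<^sub># (image_mset \<phi> W) < m"
      using sum_mset_pos_bounds[OF N(2) sub] t by (simp_all add: t_def)
    ultimately have "\<Sum>\<^sub># (image_mset \<phi> W) = s" by simp
    with sub show "\<exists>W. W \<subseteq># N \<and> \<Sum>\<^sub># W = s" by blast
  next
    fix W assume W: "W \<subseteq># N + Z'" "m dvd \<Sum>\<^sub># W"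
    then obtain U where U: "U \<subseteq># T" "W = image_mset \<phi> U"
      unfolding \<phi>_T[symmetric] using subset_image_msetE by blast
    then have "size U \<le> size Z" using W(2) \<phi>_dvd Z(3) by simp
    then show "size W \<le> size Z'" by (simp add: U Z'_def)
  qed (rule that, assumption+)
  define \<alpha> where "\<alpha> = N + replicate_mset p 1"
  define \<beta> where "\<beta> = replicate_mset h 0 + image_mset (\<lambda>x. m - x) M"
  have "1 < m" using t V_pos by linarith
  have \<alpha>_range: "1 \<le> k \<and> k < m" if "k \<in># \<alpha>" for k
    using that N(2) N_le t(2) \<open>1 < m\<close> by (fastforce simp: \<alpha>_def split: if_splits)
  have \<beta>_range: "0 \<le> k \<and> k < m" if "k \<in># \<beta>" for k
    using that M(2) m by (fastforce simp: \<beta>_def split: if_splits)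
  have "image_mset (least_pos_rep n) \<alpha> = image_mset (\<lambda>k. k) \<alpha>"
    using \<alpha>_range by (intro image_mset_cong least_pos_rep_eq) (fastforce simp: m_def)+
  then have "L n \<alpha> < m" using M(3) by (simp add: L_def \<alpha>_def)
  \<comment> \<open>Each zero contributes 1 and each \<open>m - x\<close> contributes
    \<open>x + 1\<close>. As \<open>M\<close> has sum \<open>p\<close>, the total is
    \<open>h + p + size M = h + size Z\<close>, below \<open>n\<close> by the bound on zero sums in
    \<open>T\<close>.\<close>
  moreover have "L n (one_minus n \<beta>) < m"
  proof -
    have 0: "least_pos_rep n ((1 - 0) mod int n) = 1"
      using n by (intro least_pos_rep_eq) auto
    have "image_mset (\<lambda>x. least_pos_rep n ((1 - (m - x)) mod int n)) M = image_mset (\<lambda>x. x + 1) M"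
    proof (intro image_mset_cong least_pos_rep_eq)
      fix x assume "x \<in># M"
      then show "1 \<le> x + 1" "x + 1 \<le> int n" using M(2)[of x] by (simp_all add: m_def)
      have "(x + 1 - int n) mod int n = (x + 1) mod int n" by (rule minus_mod_self2)
      moreover have "1 - (m - x) = x + 1 - int n" by (simp add: m_def)
      ultimately show "[x + 1 = (1 - (m - x)) mod int n] (mod int n)"
        by (simp only: cong_def mod_mod_trivial)
    qed
    then have "L n (one_minus n \<beta>) = int h + (\<Sum>x\<in>#M. x + 1)"
      using 0 by (simp add: L_def one_minus_def \<beta>_def image_mset.compositionality comp_def)
    also have "\<dots> = int h + int (size Z')"
      by (simp add: M(1,4) sum_mset.distrib)
    finally show ?thesis using Z_size by (simp add: Z'_def m_def)
  qed
  moreover have "similar n \<gamma> (\<alpha> + \<beta>)"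
  proof -
    \<comment> \<open>The composite of \<open>\<tau>\<close> and \<open>\<phi>\<close>, with its
      constant term reduced to lie in \<open>Zmod n\<close>.\<close>
    define f where "f x = (g' * x + (- g' * a) mod m) mod m" for x
    have f: "f x = \<phi> (\<tau> x)" for x
      by (simp add: f_def \<phi>_def \<tau>_def mod_simps algebra_simps)
    have "affine_map n f"
      unfolding affine_map_def
      by (intro exI[of _ g'] exI[of _ "(- g' * a) mod m"])
        (use \<open>coprime g' m\<close> m in \<open>auto simp: f_def m_def Zmod_def\<close>)
    moreover have "image_mset f \<gamma> = \<alpha> + \<beta>"
    proof -
      have "f a = 0" by (simp add: f \<phi>_def \<tau>_def)
      moreover have "image_mset f \<gamma>' = N + Z'"
        unfolding \<phi>_T[symmetric] T_def image_mset.compositionality comp_def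
        by (intro image_mset_cong f)
      ultimately have "image_mset f \<gamma> = replicate_mset h 0 + (N + Z')"
        by (subst \<gamma>_split) simp
      then show ?thesis by (simp add: M(1) \<alpha>_def \<beta>_def ac_simps)
    qed
    ultimately show ?thesis by (auto simp: similar_def)
  qed
  ultimately show ?thesis
    using \<alpha>_range \<beta>_range
    by (intro exI[of _ \<alpha>] exI[of _ \<beta>]) (force simp: seq_in_Zmod_def Zmod_def m_def)
qed

section \<open>Both directions of the equivalence\<close>

theorem theorem2:
  fixes n :: nat and \<gamma> :: "int multiset"
  assumes "n \<ge> 1"
    and "seq_in_Zmod n \<gamma>"
    and "real (size \<gamma>) > 3 * real n / 2 - 1"
  shows "\<not> (\<exists>\<delta>. \<delta> \<subseteq># \<gamma> \<and> size \<delta> = n \<and> [\<Sum>\<^sub># \<delta> = 0] (mod int n)) \<longleftrightarrow>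
    (\<exists>\<alpha> \<beta>. seq_in_Zmod n \<alpha> \<and> seq_in_Zmod n \<beta> \<and> similar n \<gamma> (\<alpha> + \<beta>) \<and>
      L n \<alpha> < int n \<and> L n (one_minus n \<beta>) < int n)"
  (is "?nz \<longleftrightarrow> ?similar")
proof
  assume ?nz
  moreover have "3 * n < 2 * size \<gamma> + 2" using assms(3) by linarith
  ultimately show ?similar
    using no_zero_sum_structure[OF assms(1,2)] by (auto simp: cong_0_iff)
next
  assume ?similar
  then obtain \<alpha> \<beta> f where f: "affine_map n f" "\<alpha> + \<beta> = image_mset f \<gamma>"
    and L: "L n \<alpha> < int n" "L n (one_minus n \<beta>) < int n"
    by (auto simp: similar_def)
  from f(1) obtain c b where c: "coprime c (int n)"
    "\<And>x. x \<in> Zmod n \<Longrightarrow> f x = (c * x + b) mod int n"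
    by (auto simp: affine_map_def)
  show ?nz
  proof clarify
    fix \<delta> assume \<delta>: "\<delta> \<subseteq># \<gamma>" "[\<Sum>\<^sub># \<delta> = 0] (mod int (size \<delta>))" and n: "n = size \<delta>"
    have "image_mset f \<delta> \<subseteq># \<alpha> + \<beta>"
      unfolding f(2) using \<delta>(1) by (rule image_mset_subseteq_mono)
    then have "\<not> int n dvd \<Sum>\<^sub># (image_mset f \<delta>)"
      using union_no_zero_sum[OF assms(1) L] n by simp
    moreover have "image_mset f \<delta> = image_mset (\<lambda>x. (c * x + b) mod int n) \<delta>"
      using assms(2) mset_subset_eqD[OF \<delta>(1)]
      by (intro image_mset_cong c(2)) (auto simp: seq_in_Zmod_def)
    moreover have "int n dvd \<Sum>\<^sub># \<delta>" using \<delta>(2) by (simp add: n cong_0_iff)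
    \<comment> \<open>Since \<open>\<delta>\<close> has length \<open>n\<close>, the constant term
      \<open>b\<close> adds a multiple of \<open>n\<close>, so the affine image would also have sum
      zero.\<close>
    ultimately show False
      using dvd_sum_image_affine[OF c(1), of \<delta> b] n by simp
  qed
qed

end
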